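(* The set of simple involutions avoiding the pattern $2341$ is exactly the union of the set of simple involutions avoiding $123$ with the single permutation $5274163$.
   Context: An involution is a permutation equal to its own inverse. A permutation $\pi$ avoids $\sigma$ if no subsequence of $\pi$ has the same relative order as $\sigma$. An interval of $\pi_1\cdots\pi_n$ is a set of positionally contiguous entries whose values form a set of consecutive integers; $\pi$ is simple if its only intervals have size $1$ or $n$. *)

theory Defs
  imports
    "HOL-Library.Sublist"
    "HOL-Combinatorics.Permutations"
    "HOL-Combinatorics.Multiset_Permutations"
begin

(* Permutations of {1..n} are represented by their one-line notation, the list
   [\<pi>(1), ..., \<pi>(n)], so that the length n is part of the object and permutations of
   all lengths live in one type. *)

definition is_permutation :: "nat list \<Rightarrow> bool" where
  "is_permutation w \<longleftrightarrow> w \<in> permutations_of_set {1..length w}"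

(* The function i \<mapsto> \<pi>(i) denoted by a word: list positions are counted from 0, points
   from 1, and points outside {1..n} are fixed. *)
definition perm_of_word :: "nat list \<Rightarrow> nat \<Rightarrow> nat" where
  "perm_of_word w i = (if i \<in> {1..length w} then w ! (i - 1) else i)"

lemma perm_of_word_permutes:
  assumes "is_permutation w"
  shows "perm_of_word w permutes {1..length w}"
proof (rule bij_imp_permutes)
  have w: "set w = {1..length w}" "distinct w"
    using assms by (auto simp: is_permutation_def permutations_of_set_def)
  have "bij_betw (\<lambda>i. w ! (i - 1)) {1..length w} {1..length w}"
  proof -
    have "bij_betw (\<lambda>i. i - 1) {1..length w} {..<length w}"
      by (rule bij_betw_byWitness[where f' = Suc]) auto
    moreover have "bij_betw ((!) w) {..<length w} {1..length w}"
      using w by (intro bij_betw_nth) auto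
    ultimately have "bij_betw ((!) w \<circ> (\<lambda>i. i - 1)) {1..length w} {1..length w}"
      by (rule bij_betw_trans)
    then show ?thesis by (simp add: o_def)
  qed
  then show "bij_betw (perm_of_word w) {1..length w} {1..length w}"
    by (rule bij_betw_cong[THEN iffD1, rotated]) (simp add: perm_of_word_def)
qed (auto simp: perm_of_word_def)

definition is_involution :: "nat list \<Rightarrow> bool" where
  "is_involution w \<longleftrightarrow> is_permutation w \<and> inv (perm_of_word w) = perm_of_word w"

definition same_relative_order :: "nat list \<Rightarrow> nat list \<Rightarrow> bool" where
  "same_relative_order u v \<longleftrightarrow>
     length u = length v \<and>
     (\<forall>i < length u. \<forall>j < length u. u ! i < u ! j \<longleftrightarrow> v ! i < v ! j)"

definition avoids :: "nat list \<Rightarrow> nat list \<Rightarrow> bool" where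
  "avoids w \<sigma> \<longleftrightarrow> \<not> (\<exists>u. subseq u w \<and> same_relative_order u \<sigma>)"

(* Intervals are nonempty sets of entries; without this the empty set, of size 0,
   would prevent every permutation from being simple. *)
definition is_interval_of :: "nat set \<Rightarrow> nat list \<Rightarrow> bool" where
  "is_interval_of S w \<longleftrightarrow>
     S \<noteq> {} \<and> (\<exists>u. sublist u w \<and> S = set u) \<and> (\<exists>a b. S = {a..b})"

definition is_simple :: "nat list \<Rightarrow> bool" where
  "is_simple w \<longleftrightarrow> (\<forall>S. is_interval_of S w \<longrightarrow> card S = 1 \<or> card S = length w)"

definition simple_involutions_avoiding :: "nat list \<Rightarrow> nat list set" where
  "simple_involutions_avoiding \<sigma> = {w. is_involution w \<and> is_simple w \<and> avoids w \<sigma>}"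

end

theory Submission
  imports Defs
begin

text \<open>
  An involution avoiding 2341 also avoids 4123. Let \<open>f\<close> be such a simple involution of \<open>{1..n}\<close>
  that contains 123, and put \<open>m = f 1\<close>, \<open>l = f n\<close>. Since the value 1 sits at position \<open>m\<close> and the
  value \<open>n\<close> at position \<open>l\<close>, every occurrence of 123 has its first point in \<open>{1..<l}\<^sup>2\<close> and its last
  one in \<open>{m<..n}\<^sup>2\<close>. Indecomposability forces \<open>l < m\<close>, and then the middle point lies in
  \<open>{l<..<m}\<^sup>2\<close>. It follows that \<open>f\<close> is decreasing on \<open>{1..<l}\<close>, on \<open>{m<..n}\<close> and on the points of
  the middle block \<open>{l<..<m}\<^sup>2\<close>, so that by simplicity each of the three diagonal blocks
  consists of a single fixed point. Finally \<open>f\<close> maps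
  the interval strictly between the middle fixed point and \<open>m + 1\<close> onto \<open>{1..l - 2}\<close>, and the
  interval from \<open>l\<close> up to the middle fixed point onto \<open>{m + 2..n}\<close>. By simplicity these are
  singletons, whence \<open>n = 7\<close>.
\<close>

section \<open>Simple 2341-avoiding involutions as functions on \<open>{1..n}\<close>\<close>

locale simple_involution_avoiding_2341 =
  fixes n :: nat and f :: "nat \<Rightarrow> nat"
  assumes invol: "f (f i) = i"
    and range: "f i \<in> {1..n} \<longleftrightarrow> i \<in> {1..n}"
    and avoids_2341: "\<lbrakk>1 \<le> i; i < j; j < k; k < t; t \<le> n; f t < f i; f i < f j; f j < f k\<rbrakk> \<Longrightarrow> False"
    and simple: "\<lbrakk>1 \<le> x; x \<le> y; y \<le> n; f ` {x..y} = {u..v}\<rbrakk> \<Longrightarrow> x = y \<or> x = 1 \<and> y = n"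
begin

lemma eq_iff: "f i = f j \<longleftrightarrow> i = j"
  by (metis invol)

lemma bounds: "1 \<le> i \<Longrightarrow> i \<le> n \<Longrightarrow> 1 \<le> f i \<and> f i \<le> n"
  using range[of i] by simp

text \<open>The inverse of 2341 is 4123, and \<open>f\<close> is its own inverse: an occurrence of
  one pattern read along its values is an occurrence of the other.\<close>

lemma avoids_4123:
  "\<lbrakk>1 \<le> i; i < j; j < k; k < t; t \<le> n; f j < f k; f k < f t; f t < f i\<rbrakk> \<Longrightarrow> False"
  using avoids_2341[of "f j" "f k" "f t" "f i"] bounds[of i] bounds[of j]
  by (simp add: invol)

text \<open>Two inclusions give an equality of sets because \<open>f\<close> is its own inverse: the
  second one supplies surjectivity onto \<open>{u..v}\<close>.\<close>

lemma invariant_interval: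
  assumes "1 \<le> x" "x \<le> y" "y \<le> n" "\<And>i. x \<le> i \<Longrightarrow> i \<le> y \<Longrightarrow> u \<le> f i \<and> f i \<le> v"
    "\<And>i. u \<le> i \<Longrightarrow> i \<le> v \<Longrightarrow> x \<le> f i \<and> f i \<le> y"
  shows "x = y \<or> x = 1 \<and> y = n"
proof (rule simple[OF assms(1-3)])
  show "f ` {x..y} = {u..v}"
    using assms(4,5) by (force simp: image_iff intro: invol[symmetric])
qed

text \<open>Indecomposability: otherwise \<open>{1..k}\<close> and \<open>{k + 1..n}\<close> would
  both be invariant, hence singletons by simplicity, and \<open>n\<close> would be 2.\<close>

lemma arc_over_gap:
  assumes "1 \<le> k" "k < n" "3 \<le> n"
  obtains i where "1 \<le> i" "i \<le> k" "k < f i"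
proof -
  have False if "\<forall>i. 1 \<le> i \<longrightarrow> i \<le> k \<longrightarrow> f i \<le> k"
  proof -
    have low: "1 \<le> i \<Longrightarrow> i \<le> k \<Longrightarrow> 1 \<le> f i \<and> f i \<le> k" for i
      using that bounds[of i] assms by auto
    have high: "k + 1 \<le> i \<Longrightarrow> i \<le> n \<Longrightarrow> k + 1 \<le> f i \<and> f i \<le> n" for i
      using low[of "f i"] bounds[of i] invol[of i] by force
    have "1 = k"
      using invariant_interval[of 1 k 1 k] low assms by auto
    moreover have "k + 1 = n"
      using invariant_interval[of "k + 1" n "k + 1" n] high assms by auto
    ultimately show False using assms by auto
  qed
  then show ?thesis using that by (meson not_le)
qed

section \<open>Location of the occurrences of 123\<close>

context
  assumes ex_123: "\<exists>p q r. 1 \<le> p \<and> p < q \<and> q < r \<and> r \<le> n \<and> f p < f q \<and> f q < f r"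
begin

lemma n_ge_3: "3 \<le> n"
  using ex_123 by auto

text \<open>The value 1 sits at position \<open>f 1\<close>; to the right of a 123 it would complete
  a 2341. Dually, the value \<open>n\<close> at position \<open>f n\<close>, to the left of a 123,
  would complete a 4123.\<close>

lemma outer_position_123:
  assumes "1 \<le> p" "p < q" "q < r" "r \<le> n" "f p < f q" "f q < f r"
  shows "f 1 < r" "p < f n"
proof -
  show "f 1 < r"
  proof (rule ccontr)
    assume "\<not> f 1 < r"
    moreover have "r \<noteq> f 1" using assms bounds[of p] invol[of 1] by auto
    moreover have "f p \<noteq> 1" using assms \<open>\<not> f 1 < r\<close> invol[of p] by auto
    ultimately show False
      using avoids_2341[of p q r "f 1"] assms bounds[of 1] bounds[of p] by (auto simp: invol)
  qed
  show "p < f n"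
  proof (rule ccontr)
    assume "\<not> p < f n"
    moreover have "p \<noteq> f n" using assms bounds[of q] invol[of n] by auto
    moreover have "f r \<noteq> n" using assms \<open>\<not> p < f n\<close> invol[of r] by auto
    ultimately show False
      using avoids_4123[of "f n" p q r] assms bounds[of n] bounds[of r] by (auto simp: invol)
  qed
qed

text \<open>Reflection in the diagonal preserves 123, so every bound on positions yields the same
  bound on values.\<close>

lemma mirror_123:
  assumes "1 \<le> p" "p < q" "q < r" "r \<le> n" "f p < f q" "f q < f r"
  shows "1 \<le> f p" "f r \<le> n" "f (f p) < f (f q)" "f (f q) < f (f r)"
  using assms bounds[of p] bounds[of r] by (auto simp: invol)

lemma outer_value_123:
  assumes "1 \<le> p" "p < q" "q < r" "r \<le> n" "f p < f q" "f q < f r"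
  shows "f 1 < f r" "f p < f n"
  using outer_position_123[of "f p" "f q" "f r"] mirror_123[OF assms] assms by auto

text \<open>The largest value \<open>b\<close> on \<open>{1..m}\<close>, at position
  \<open>a\<close>, exceeds \<open>m\<close> by indecomposability. If \<open>b < n\<close>, some arc
  over \<open>b\<close> starts at a \<open>c\<close> strictly between \<open>m\<close> and
  \<open>b\<close>, and the positions \<open>1, a, c, b\<close> carry a 2341. Hence
  \<open>b = n\<close> and \<open>f n = a < m\<close>.\<close>

lemma f_n_less_f_1: "f n < f 1"
proof -
  define m where "m = f 1"
  define b where "b = Max (f ` {1..m})"
  have m: "1 \<le> m" "m < n"
    using ex_123 outer_position_123(1) bounds[of 1] n_ge_3 unfolding m_def by (force, fastforce)
  have "b \<in> f ` {1..m}"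
    unfolding b_def using m by (intro Max_in) auto
  then obtain a where a: "1 \<le> a" "a \<le> m" "f a = b" by auto
  have max: "f i \<le> b" if "1 \<le> i" "i \<le> m" for i
    unfolding b_def using that by (intro Max_ge) auto
  have "m < b"
    using arc_over_gap[of m] m n_ge_3 max by (metis le_trans not_le)
  have "f m = 1" by (simp add: m_def invol)
  have "f b = a" using a invol by auto
  have "a \<noteq> m" "a \<noteq> 1" using a \<open>m < b\<close> \<open>f m = 1\<close> m m_def by auto
  have "b = n"
  proof (rule ccontr)
    assume "b \<noteq> n"
    then have "b < n" using a bounds[of a] m by auto
    then obtain c where c: "1 \<le> c" "c \<le> b" "b < f c"
      using arc_over_gap[of b] m \<open>m < b\<close> n_ge_3 by (metis le_trans less_imp_le)
    have "m < c" using c max[of c] by force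
    moreover have "c \<noteq> b" using c \<open>f b = a\<close> a \<open>m < b\<close> by auto
    ultimately show False
      using avoids_2341[of 1 a c b] a c \<open>a \<noteq> 1\<close> \<open>a \<noteq> m\<close> \<open>m < b\<close> \<open>b < n\<close> \<open>f b = a\<close> m_def by auto
  qed
  then show ?thesis using \<open>f b = a\<close> a \<open>a \<noteq> m\<close> m_def by auto
qed

text \<open>If \<open>q\<close> lay before \<open>f n\<close>, where the value \<open>n\<close>
  sits, then \<open>p, q, f n\<close> would be a 123 ending at \<open>f n\<close>, so that
  \<open>f 1 < f n\<close>. Symmetrically, \<open>f 1, q, r\<close> would be a 123 if
  \<open>q\<close> lay after \<open>f 1\<close>.\<close>

lemma middle_123:
  assumes "1 \<le> p" "p < q" "q < r" "r \<le> n" "f p < f q" "f q < f r"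
  shows "f n < q" "q < f 1"
proof -
  have l: "1 \<le> f 1" "1 \<le> f n" "f 1 \<le> n" "f n \<le> n" "f (f n) = n" "f (f 1) = 1"
    using bounds[of 1] bounds[of n] n_ge_3 invol by auto
  have b: "1 \<le> f p" "f r \<le> n" using bounds[of p] bounds[of r] assms by auto
  show "f n < q"
  proof (rule ccontr)
    assume "\<not> f n < q"
    moreover have "q \<noteq> f n" using assms l b by auto
    ultimately show False
      using outer_position_123(1)[of p q "f n"] assms l b f_n_less_f_1 by auto
  qed
  show "q < f 1"
  proof (rule ccontr)
    assume "\<not> q < f 1"
    moreover have "q \<noteq> f 1" using assms l b by auto
    ultimately show False
      using outer_position_123(2)[of "f 1" q r] assms l b f_n_less_f_1 by auto
  qed
qed

lemma middle_value_123:
  assumes "1 \<le> p" "p < q" "q < r" "r \<le> n" "f p < f q" "f q < f r"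
  shows "f n < f q" "f q < f 1"
  using middle_123[of "f p" "f q" "f r"] mirror_123[OF assms] assms by auto

theorem eq_5274163:
  "n = 7" "f 1 = 5" "f 2 = 2" "f 3 = 7" "f 4 = 4" "f 5 = 1" "f 6 = 6" "f 7 = 3"
proof -
  define l m where "l = f n" and "m = f 1"
  have fl: "f l = n" and fm: "f m = 1" and fn: "f n = l" and f1: "f 1 = m"
    by (simp_all add: l_def m_def invol)
  have lm: "1 \<le> l" "l < m" "m \<le> n"
    using bounds[of 1] bounds[of n] n_ge_3 f_n_less_f_1 by (auto simp: l_def m_def)
  obtain p q r where pqr: "1 \<le> p" "p < q" "q < r" "r \<le> n" "f p < f q" "f q < f r"
    using ex_123 by blast
  \<comment> \<open>Most uses below are of the first two facts: a 123 ends at a position above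
    \<open>m\<close> and starts at one below \<open>l\<close>.\<close>
  note location = outer_position_123 outer_value_123 middle_123 middle_value_123
  note location = location[folded l_def m_def]
  have p: "p < l" "f p < l" and q: "l < q" "q < m" "l < f q" "f q < m" and r: "m < r" "m < f r"
    using location[OF pqr] by auto
  have bp: "1 \<le> f p" and br: "f r \<le> n" using bounds pqr by auto
  have "p \<noteq> 1" "r \<noteq> n" using p r f1 fn lm by auto
  have ne: "f i = l \<longleftrightarrow> i = n" "f i = m \<longleftrightarrow> i = 1" "f i = n \<longleftrightarrow> i = l" "f i = 1 \<longleftrightarrow> i = m" for i
    using eq_iff fl fm fn f1 by metis+
  \<comment> \<open>An ascent here extends by the point \<open>(l, n)\<close> to a 123 ending at
    \<open>l < m\<close>.\<close>
  have low_decreasing: "f j < f i" if "1 \<le> i" "i < j" "j < l" for i j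
  proof (rule ccontr)
    assume "\<not> f j < f i"
    then have "f i < f j" using eq_iff[of i j] that by auto
    moreover have "f j < n" using ne(3)[of j] bounds[of j] that lm by auto
    ultimately have "m < l" using location(1)[of i j l] that lm fl by auto
    then show False using lm by simp
  qed
  \<comment> \<open>Dually, an ascent extends by the point \<open>(m, 1)\<close> to a 123 starting
    at \<open>m > l\<close>.\<close>
  have high_decreasing: "f j < f i" if "m < i" "i < j" "j \<le> n" for i j
  proof (rule ccontr)
    assume "\<not> f j < f i"
    then have "f i < f j" using eq_iff[of i j] that by auto
    moreover have "1 < f i" using ne(4)[of i] bounds[of i] that lm by auto
    ultimately have "m < l" using location(2)[of m i j] that lm fm by auto
    then show False using lm by simp
  qed
  have low_antimono: "f j \<le> f i" if "1 \<le> i" "i \<le> j" "j < l" for i j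
    using low_decreasing[of i j] that by (cases "i = j") auto
  have high_antimono: "f j \<le> f i" if "m < i" "i \<le> j" "j \<le> n" for i j
    using high_decreasing[of i j] that by (cases "i = j") auto

  \<comment> \<open>As \<open>f\<close> is decreasing on \<open>{1..<l}\<close>, the points of \<open>{1..<l} \<times> {1..<l}\<close> form an interval.\<close>
  have p_le: "p \<le> l - 1" using p by linarith
  then have "f (l - 1) < l"
    using low_antimono[of p "l - 1"] p pqr(1) by auto
  then have l1: "1 \<le> f (l - 1)" "f (l - 1) \<le> l - 1"
    using bounds[of "l - 1"] p pqr(1) lm by auto
  have "f (l - 1) \<le> f i \<and> f i \<le> l - 1" if "f (l - 1) \<le> i" "i \<le> l - 1" for i
  proof -
    have "i < l" using that p by linarith
    then show ?thesis
      using low_antimono[of "f (l - 1)" i] low_antimono[of i "l - 1"] that l1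
      by (auto simp: invol)
  qed
  then have "f (l - 1) = l - 1 \<or> f (l - 1) = 1 \<and> l - 1 = n"
    using l1 lm by (intro invariant_interval[of _ _ "f (l - 1)" "l - 1"]) auto
  then have fix_low: "f (l - 1) = l - 1"
    using lm by auto
  have p_eq: "p = l - 1"
    using low_decreasing[of p "l - 1"] p p_le pqr(1) fix_low by linarith
  then have "3 \<le> l" using \<open>p \<noteq> 1\<close> pqr(1) by linarith

  \<comment> \<open>Dually, the points with position and value above \<open>m\<close> occupy the
    positions \<open>m + 1\<close> to \<open>f (m + 1)\<close> and form an interval.\<close>
  have "m < f (m + 1)"
    using high_antimono[of "m + 1" r] r pqr(4) by auto
  then have m1: "f (m + 1) \<le> n" "m + 1 \<le> f (m + 1)"
    using bounds[of "m + 1"] r pqr(4) by auto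
  have "m + 1 \<le> f i \<and> f i \<le> f (m + 1)" if "m + 1 \<le> i" "i \<le> f (m + 1)" for i
    using high_antimono[of "m + 1" i] high_antimono[of i "f (m + 1)"] that m1
    by (auto simp: invol)
  then have "m + 1 = f (m + 1) \<or> m + 1 = 1 \<and> f (m + 1) = n"
    using m1 by (intro invariant_interval[of _ _ "m + 1" "f (m + 1)"]) auto
  then have fix_high: "f (m + 1) = m + 1"
    using lm by auto
  have r_eq: "r = m + 1"
    using high_decreasing[of "m + 1" r] r pqr(4) fix_high by (cases "r = m + 1") auto
  then have "m + 2 \<le> n" using \<open>r \<noteq> n\<close> pqr(4) by linarith

  have fp: "f p = p" and fr: "f r = r" using p_eq fix_low r_eq fix_high by auto
  have centre_fixed: "f x = x" if x: "l < x" "x < m" "l < f x" "f x < m" for x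
  proof -
    \<comment> \<open>\<open>f\<close> preserves \<open>{y..f y}\<close>: inside it, a value above
      \<open>f y\<close> would give a 123 starting at the fixed point \<open>p\<close> and ending
      before \<open>m\<close>, a value below \<open>y\<close> one ending at the fixed point
      \<open>r\<close> and starting after \<open>l\<close>.\<close>
    have *: "f y = y" if y: "l < y" "f y < m" "y \<le> f y" for y
    proof -
      have "y \<le> f i \<and> f i \<le> f y" if i: "y \<le> i" "i \<le> f y" for i
      proof (cases "i = y \<or> i = f y")
        case True
        then show ?thesis using y by (auto simp: invol)
      next
        case False
        then have i: "y < i" "i < f y" using i by auto
        have "\<not> f y < f i"
          using location(1)[of p y i] fp i y lm pqr(1) p by auto
        moreover have "\<not> f i < y"
          using location(2)[of i "f y" r] fr i y lm pqr(4) r by (auto simp: invol)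
        ultimately show ?thesis by auto
      qed
      then show ?thesis
        using invariant_interval[of y "f y" y "f y"] y lm by auto
    qed
    show ?thesis
    proof (cases "x \<le> f x")
      case False
      then show ?thesis using *[of "f x"] x by (auto simp: invol)
    qed (use * x in auto)
  qed
  have fq: "f q = q" using centre_fixed q by auto
  \<comment> \<open>Two fixed points in the middle block would form, together with \<open>p\<close>,
    a 123 ending before \<open>m\<close>.\<close>
  have centre_unique: "x = q" if x: "l < x" "x < m" "l < f x" "f x < m" for x
    using centre_fixed[OF x] fq location(1)[of p x q] location(1)[of p q x] x q p lm pqr fp
    by (cases x q rule: linorder_cases) auto

  \<comment> \<open>A value below \<open>l\<close> would make \<open>i, q, r\<close> a 123 starting
    after \<open>l\<close>; values strictly between \<open>l\<close> and \<open>m\<close> are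
    excluded by uniqueness of the central point.\<close>
  have left: "m < f i" if "l < i" "i < q" for i
  proof -
    have "\<not> f i < l" using location(2)[of i q r] that pqr q lm by auto
    then show ?thesis
      using centre_unique[of i] ne(1,2)[of i] that q lm by (metis less_irrefl less_le_trans less_trans linorder_neqE_nat not_le)
  qed
  have right: "f i < l" if "q < i" "i < m" for i
  proof -
    have "\<not> m < f i" using location(1)[of p q i] that pqr q lm by auto
    then show ?thesis
      using centre_unique[of i] ne(1,2)[of i] that q lm by (metis less_irrefl less_le_trans less_trans linorder_neqE_nat not_le)
  qed
  have top: "q < f i \<and> f i < m" if "1 < i" "i \<le> l - 2" for i
  proof -
    have "i < l - 1" using that \<open>3 \<le> l\<close> by linarith
    note that = that(1) this
    have "f i < m" using low_decreasing[of 1 i] that f1 by auto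
    moreover have "l - 1 < f i" using low_decreasing[of i "l - 1"] that fix_low by auto
    then have "l \<le> f i" by linarith
    moreover have "f i \<noteq> l" "f i \<noteq> q" using ne[of i] eq_iff[of i q] fq that q lm by auto
    \<comment> \<open>Otherwise \<open>left\<close> at position \<open>f i\<close> would give
      \<open>m < i\<close>.\<close>
    moreover have "\<not> f i < q"
      using left[of "f i"] that lm calculation by (auto simp: invol)
    ultimately show ?thesis by auto
  qed
  have bot: "l < f i \<and> f i < q" if "m + 1 < i" "i < n" for i
  proof -
    have "l < f i" using high_decreasing[of i n] that fn by auto
    moreover have "f i < m + 1" using high_decreasing[of "m + 1" i] that fix_high by auto
    moreover have "f i \<noteq> m" "f i \<noteq> q" using ne[of i] eq_iff[of i q] fq that q lm by auto
    moreover have "\<not> q < f i"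
      using right[of "f i"] that lm calculation by (auto simp: invol)
    ultimately show ?thesis by auto
  qed

  \<comment> \<open>\<open>f\<close> exchanges \<open>{q + 1..m}\<close> and
    \<open>{1..l - 2}\<close>: the value \<open>l - 1\<close> is missed because it is a fixed point,
    and the endpoint \<open>m\<close> is matched with 1.\<close>
  have m_eq: "m = q + 1"
  proof -
    have "1 \<le> f i \<and> f i \<le> l - 2" if "q + 1 \<le> i" "i \<le> m" for i
      using right[of i] that bounds[of i] eq_iff[of i "l - 1"] fix_low fm q lm \<open>3 \<le> l\<close>
      by (cases "i = m") auto
    moreover have "q + 1 \<le> f i \<and> f i \<le> m" if "1 \<le> i" "i \<le> l - 2" for i
      using top[of i] that f1 q \<open>3 \<le> l\<close> by (cases "i = 1") auto
    ultimately have "q + 1 = m \<or> q + 1 = 1 \<and> m = n"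
      using q lm by (intro invariant_interval[of _ _ 1 "l - 2"]) auto
    then show ?thesis using q by auto
  qed
  have l_eq: "l = q - 1"
  proof -
    have "m + 2 \<le> f i \<and> f i \<le> n" if "l \<le> i" "i \<le> q - 1" for i
    proof -
      have "i < q" using that q by linarith
      then show ?thesis
        using left[of i] that bounds[of i] eq_iff[of i "m + 1"] fix_high fl q lm \<open>m + 2 \<le> n\<close>
        by (cases "i = l") (force, auto)
    qed
    moreover have "l \<le> f i \<and> f i \<le> q - 1" if "m + 2 \<le> i" "i \<le> n" for i
      using bot[of i] that fn q \<open>m + 2 \<le> n\<close> by (cases "i = n") auto
    ultimately have "l = q - 1 \<or> l = 1 \<and> q - 1 = n"
      using q lm by (intro invariant_interval[of _ _ "m + 2" n]) auto
    then show ?thesis using q lm by auto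
  qed
  \<comment> \<open>Now no integer lies strictly between \<open>q\<close> and \<open>m\<close>, or
    between \<open>l\<close> and \<open>q\<close>, so \<open>top\<close> and \<open>bot\<close> must
    be vacuous; this bounds \<open>l\<close> and \<open>n\<close>.\<close>
  have "\<not> 2 \<le> l - 2" using top[of 2] m_eq by auto
  then have "l = 3" using \<open>3 \<le> l\<close> by linarith
  moreover have "\<not> m + 1 < n - 1" using bot[of "n - 1"] l_eq by auto
  then have "n = m + 2" using \<open>m + 2 \<le> n\<close> by linarith
  moreover have "q = 4" using l_eq \<open>l = 3\<close> q by linarith
  ultimately show "n = 7" "f 1 = 5" "f 2 = 2" "f 3 = 7" "f 4 = 4" "f 5 = 1" "f 6 = 6" "f 7 = 3"
    using m_eq fix_low fix_high fl fm fn f1 fq by auto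
qed

end
end

section \<open>Relative order with the patterns 123 and 2341\<close>

lemma same_relative_order_nth:
  "same_relative_order u v \<Longrightarrow> i < length u \<Longrightarrow> j < length u \<Longrightarrow> u ! i < u ! j \<longleftrightarrow> v ! i < v ! j"
  by (simp add: same_relative_order_def)

lemma same_relative_order_123:
  assumes "a < b" "b < c"
  shows "same_relative_order [a, b, c] [1, 2, 3]"
  unfolding same_relative_order_def
proof (intro conjI allI impI)
  fix i j assume "i < length [a, b, c]" "j < length [a, b, c]"
  then have "i \<in> {0, 1, 2}" "j \<in> {0, 1, 2}" by auto
  then show "[a, b, c] ! i < [a, b, c] ! j \<longleftrightarrow> [1, 2, 3::nat] ! i < [1, 2, 3] ! j"
    using assms by (elim insertE emptyE) simp_all
qed simp

lemma same_relative_order_2341: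
  assumes "d < a" "a < b" "b < c"
  shows "same_relative_order [a, b, c, d] [2, 3, 4, 1]"
  unfolding same_relative_order_def
proof (intro conjI allI impI)
  fix i j assume "i < length [a, b, c, d]" "j < length [a, b, c, d]"
  then have "i \<in> {0, 1, 2, 3}" "j \<in> {0, 1, 2, 3}" by auto
  then show "[a, b, c, d] ! i < [a, b, c, d] ! j \<longleftrightarrow> [2, 3, 4, 1::nat] ! i < [2, 3, 4, 1] ! j"
    using assms by (elim insertE emptyE) simp_all
qed simp

lemma same_relative_order_2341_nth:
  assumes "same_relative_order u [2, 3, 4, 1]"
  shows "length u = 4" "u ! 3 < u ! 0" "u ! 0 < u ! 1" "u ! 1 < u ! 2"
proof -
  show "length u = 4" using assms by (simp add: same_relative_order_def)
  then show "u ! 3 < u ! 0" "u ! 0 < u ! 1" "u ! 1 < u ! 2"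
    using same_relative_order_nth[OF assms, of 3 0] same_relative_order_nth[OF assms, of 0 1]
      same_relative_order_nth[OF assms, of 1 2] by simp_all
qed

lemma same_relative_order_123_nth:
  assumes "same_relative_order u [1, 2, 3]"
  shows "length u = 3" "u ! 0 < u ! 1" "u ! 1 < u ! 2"
proof -
  show "length u = 3" using assms by (simp add: same_relative_order_def)
  then show "u ! 0 < u ! 1" "u ! 1 < u ! 2"
    using same_relative_order_nth[OF assms, of 0 1] same_relative_order_nth[OF assms, of 1 2]
    by simp_all
qed

text \<open>Reduces simplicity to a finite check by evaluation: an entry of \<open>w\<close> missing
  from \<open>u\<close> but lying between two of its values shows that \<open>set u\<close> is not a
  set of consecutive integers.\<close>

lemma is_simpleI:
  assumes "distinct w"
    and gap: "\<forall>u \<in> set (sublists w). length u \<le> 1 \<or> length u = length w \<or>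
      (\<exists>x\<in>set u. \<exists>z\<in>set u. \<exists>y\<in>set w. x < y \<and> y < z \<and> y \<notin> set u)"
  shows "is_simple w"
  unfolding is_simple_def
proof (intro allI impI)
  fix S assume "is_interval_of S w"
  then obtain u a b where u: "sublist u w" "S = set u" "set u = {a..b}" "S \<noteq> {}"
    unfolding is_interval_of_def by metis
  have convex: "\<not> (\<exists>x\<in>set u. \<exists>z\<in>set u. \<exists>y\<in>set w. x < y \<and> y < z \<and> y \<notin> set u)"
    unfolding u(3) by auto
  have "u \<in> set (sublists w)" using u(1) by simp
  then have "length u \<le> 1 \<or> length u = length w"
    using bspec[OF gap, of u] convex by argo
  moreover have "distinct u"
    using u(1) assms(1) unfolding sublist_def by auto
  then have "card S = length u"
    unfolding u(2) by (rule distinct_card)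
  moreover have "u \<noteq> []" using u(2,4) by auto
  ultimately show "card S = 1 \<or> card S = length w"
    by (cases u) auto
qed

section \<open>The exceptional permutation 5274163\<close>

lemma is_simple_5274163: "is_simple [5, 2, 7, 4, 1, 6, 3]" (is "is_simple ?w")
proof (rule is_simpleI)
  show "distinct ?w" by simp
  show "\<forall>u \<in> set (sublists ?w). length u \<le> 1 \<or> length u = length ?w \<or>
      (\<exists>x\<in>set u. \<exists>z\<in>set u. \<exists>y\<in>set ?w. x < y \<and> y < z \<and> y \<notin> set u)"
    by code_simp
qed

lemma is_involution_5274163: "is_involution [5, 2, 7, 4, 1, 6, 3]" (is "is_involution ?w")
proof -
  have perm: "is_permutation ?w"
    unfolding is_permutation_def permutations_of_set_def by auto
  have "perm_of_word ?w (perm_of_word ?w i) = i" for i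
  proof (cases "i \<in> {1..length ?w}")
    case True
    have "\<forall>i \<in> set [1..<8]. perm_of_word ?w (perm_of_word ?w i) = i"
      by code_simp
    moreover have "i \<in> set [1..<8]" using True by simp
    ultimately show ?thesis by blast
  next
    case False
    then show ?thesis using permutes_not_in[OF perm_of_word_permutes[OF perm]] by metis
  qed
  then have "inv (perm_of_word ?w) = perm_of_word ?w"
    by (intro inv_unique_comp) (auto simp: fun_eq_iff)
  with perm show ?thesis by (simp only: is_involution_def simp_thms)
qed

lemma avoids_5274163: "avoids [5, 2, 7, 4, 1, 6, 3] [2, 3, 4, 1]" (is "avoids ?w _")
proof -
  have "\<forall>u \<in> set (subseqs ?w). length u = 4 \<longrightarrow>
    \<not> (u ! 3 < u ! 0 \<and> u ! 0 < u ! 1 \<and> u ! 1 < u ! 2)"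
    by code_simp
  then show ?thesis
    unfolding avoids_def in_set_subseqs by (meson same_relative_order_2341_nth in_set_subseqs)
qed

section \<open>Translation from words to functions, and the classification\<close>

lemma subseq_map_nth:
  assumes "sorted_wrt (<) js" "set js \<subseteq> {..<length w}"
  shows "subseq (map ((!) w) js) w"
proof -
  have "subseq js [0..<length w]"
    using assms by (intro sorted_subset_imp_subseq) auto
  then show ?thesis by (metis map_nth subseq_map)
qed

lemma subseq_map_nthE:
  assumes "subseq u w"
  obtains js where "sorted_wrt (<) js" "set js \<subseteq> {..<length w}" "u = map ((!) w) js"
proof -
  obtain N where "u = nths w N" using assms by (auto simp: subseq_conv_nths)
  then have "u = map ((!) w) (nths [0..<length w] N)"
    by (metis map_nth nths_map)
  moreover have "sorted_wrt (<) (nths [0..<length w] N)"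
    using sorted_nths[of "[0..<length w]" N] distinct_nthsI[of "[0..<length w]" N]
    by (auto simp: strict_sorted_iff)
  moreover have "set (nths [0..<length w] N) \<subseteq> {..<length w}"
    using set_nths_subset[of "[0..<length w]" N] by auto
  ultimately show ?thesis using that by blast
qed

text \<open>The first three entries of a 2341 form a 123.\<close>

lemma avoids_2341_if_avoids_123:
  assumes "avoids w [1, 2, 3]"
  shows "avoids w [2, 3, 4, 1]"
  unfolding avoids_def
proof (intro notI, elim exE conjE)
  fix u assume u: "subseq u w" "same_relative_order u [2, 3, 4, 1]"
  note order = same_relative_order_2341_nth[OF u(2)]
  have "subseq (map ((!) u) [0, 1, 2]) u"
    using order by (intro subseq_map_nth) auto
  then have "subseq [u ! 0, u ! 1, u ! 2] w"
    using u(1) subseq_order.trans by auto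
  then show False
    using assms same_relative_order_123[OF order(3,4)] unfolding avoids_def by blast
qed

lemma perm_of_word_123:
  assumes "\<not> avoids w [1, 2, 3]"
  shows "\<exists>p q r. 1 \<le> p \<and> p < q \<and> q < r \<and> r \<le> length w \<and>
    perm_of_word w p < perm_of_word w q \<and> perm_of_word w q < perm_of_word w r"
proof -
  obtain u where u: "subseq u w" "same_relative_order u [1, 2, 3]"
    using assms by (auto simp: avoids_def)
  obtain js where js: "sorted_wrt (<) js" "set js \<subseteq> {..<length w}" "u = map ((!) w) js"
    using subseq_map_nthE[OF u(1)] by blast
  have "length js = 3"
    using same_relative_order_123_nth(1)[OF u(2)] js(3) by simp
  then obtain i j k where "js = [i, j, k]"
    by (auto simp: numeral_3_eq_3 length_Suc_conv)
  then have "Suc i < Suc j" "Suc j < Suc k" "Suc k \<le> length w"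
    "perm_of_word w (Suc i) < perm_of_word w (Suc j)"
    "perm_of_word w (Suc j) < perm_of_word w (Suc k)"
    using js same_relative_order_123_nth[OF u(2)] by (auto simp: perm_of_word_def)
  then show ?thesis by (intro exI[of _ "Suc i"] exI[of _ "Suc j"] exI[of _ "Suc k"]) simp
qed

lemma perm_of_word_avoids_2341:
  assumes "avoids w [2, 3, 4, 1]" "1 \<le> i" "i < j" "j < k" "k < t" "t \<le> length w"
    "perm_of_word w t < perm_of_word w i" "perm_of_word w i < perm_of_word w j"
    "perm_of_word w j < perm_of_word w k"
  shows False
proof -
  have "subseq (map ((!) w) [i - 1, j - 1, k - 1, t - 1]) w"
    using assms by (intro subseq_map_nth) auto
  then have "subseq [perm_of_word w i, perm_of_word w j, perm_of_word w k, perm_of_word w t] w"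
    using assms by (simp add: perm_of_word_def)
  then show False
    using assms(1) same_relative_order_2341[OF assms(7-9)] by (auto simp: avoids_def)
qed

lemma perm_of_word_simple:
  assumes "is_permutation w" "is_simple w" "1 \<le> x" "x \<le> y" "y \<le> length w"
    and img: "perm_of_word w ` {x..y} = {u..v}"
  shows "x = y \<or> x = 1 \<and> y = length w"
proof -
  \<comment> \<open>The contiguous factor at points \<open>x\<close> to \<open>y\<close>; the shift
    by one comes from list positions starting at 0.\<close>
  define s where "s = take (Suc y - x) (drop (x - 1) w)"
  have len: "length s = Suc y - x" using assms(3-5) by (simp add: s_def)
  have "s = map (perm_of_word w) [x..<Suc y]"
    using assms(3-5) len
    by (intro nth_equalityI) (auto simp: s_def perm_of_word_def simp del: upt_Suc)
  then have "set s = perm_of_word w ` {x..y}"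
    by (simp add: atLeastLessThanSuc_atLeastAtMost del: upt_Suc)
  moreover have "sublist s w"
    unfolding s_def by (rule sublist_order.order.trans[OF sublist_take sublist_drop])
  ultimately have "is_interval_of {u..v} w"
    using img assms(4) by (auto simp: is_interval_of_def)
  then have "card {u..v} = 1 \<or> card {u..v} = length w"
    using assms(2) unfolding is_simple_def by blast
  moreover have "card {u..v} = Suc y - x"
    using card_image[OF permutes_inj_on[OF perm_of_word_permutes[OF assms(1)]], of "{x..y}"] img
    by simp
  ultimately show ?thesis using assms(3-5) by auto
qed

text \<open>As \<open>perm_of_word w\<close> fixes every point outside \<open>{1..length w}\<close>,
  the first two locale assumptions hold for all natural numbers.\<close>

lemma simple_involution_perm_of_word:
  assumes "is_involution w" "is_simple w" "avoids w [2, 3, 4, 1]"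
  shows "simple_involution_avoiding_2341 (length w) (perm_of_word w)"
proof
  have perm: "is_permutation w" using assms(1) by (simp add: is_involution_def)
  note permutes = perm_of_word_permutes[OF perm]
  show "perm_of_word w (perm_of_word w i) = i" for i
    using assms(1) permutes_inverses(1)[OF permutes, of i] by (simp add: is_involution_def)
  show "perm_of_word w i \<in> {1..length w} \<longleftrightarrow> i \<in> {1..length w}" for i
    using permutes_in_image[OF permutes] .
  show "x = y \<or> x = 1 \<and> y = length w"
    if "1 \<le> x" "x \<le> y" "y \<le> length w" "perm_of_word w ` {x..y} = {u..v}" for x y u v
    using perm_of_word_simple[OF perm assms(2) that] .
qed (use perm_of_word_avoids_2341[OF assms(3)] in blast)

lemma eq_5274163_if_contains_123:
  assumes "is_involution w" "is_simple w" "avoids w [2, 3, 4, 1]" "\<not> avoids w [1, 2, 3]"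
  shows "w = [5, 2, 7, 4, 1, 6, 3]"
proof -
  note vals = simple_involution_avoiding_2341.eq_5274163
    [OF simple_involution_perm_of_word[OF assms(1-3)] perm_of_word_123[OF assms(4)]]
  have "length w = 7" by (rule vals(1))
  then obtain a b c d e g h where w: "w = [a, b, c, d, e, g, h]"
    by (auto simp: numeral_eq_Suc length_Suc_conv)
  show ?thesis
    using vals(2-) unfolding w by (simp add: perm_of_word_def)
qed

theorem theorem3p6:
  shows "simple_involutions_avoiding [2, 3, 4, 1] =
         simple_involutions_avoiding [1, 2, 3] \<union> {[5, 2, 7, 4, 1, 6, 3]}"
  using eq_5274163_if_contains_123 avoids_2341_if_avoids_123
    is_involution_5274163 is_simple_5274163 avoids_5274163
  unfolding simple_involutions_avoiding_def by blast

end
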